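(* Let $M^{2n+1}(\varphi,Q,\xi,\eta,g)$ be a weak nearly Sasakian manifold such that, with $\widetilde Q=Q-\mathrm{id}_{TM}$, (i) $(\nabla_X\widetilde Q)Y=0$ for all vector fields $X$ on $M$ and all $Y\in\ker\eta$, and (ii) $R_{\widetilde QX,Y}Z\in\ker\eta$ for all $X,Y,Z\in\ker\eta$. Then $$g(R_{\xi,Z}\,\varphi X,\varphi Y)=0$$ for all vector fields $X,Y,Z$ on $M$; hence $\ker\eta$ is a curvature invariant distribution, i.e. $R_{X,Y}Z\in\ker\eta$ for all $X,Y,Z\in\ker\eta$.
   Context: All objects are smooth. A weak almost contact metric structure on a smooth manifold $M^{2n+1}$ ($n\ge1$) is a tuple $(\varphi,Q,\xi,\eta,g)$, where $\varphi$ is a $(1,1)$-tensor, $Q$ a nonsingular $(1,1)$-tensor, $\xi$ a vector field, $\eta$ a 1-form and $g$ a Riemannian metric, such that $\varphi^2=-Q+\eta\otimes\xi$, $\eta(\xi)=1$, $Q\xi=\xi$, $\varphi(\ker\eta)\subset\ker\eta$, and $g(\varphi X,\varphi Y)=g(X,QY)-\eta(X)\eta(Y)$ for all vector fields $X,Y$. (Consequently $\varphi\xi=0$, $\eta=g(\xi,\cdot)$, $\varphi$ is skew-symmetric and $Q$ is self-adjoint.) It is weak nearly Sasakian if $(\nabla_Y\varphi)Z+(\nabla_Z\varphi)Y=2g(Y,Z)\xi-\eta(Z)Y-\eta(Y)Z$ for all vector fields $Y,Z$, where $\nabla$ is the Levi-Civita connection of $g$. The curvature tensor is $R_{X,Y}Z=\nabla_X\nabla_YZ-\nabla_Y\nabla_XZ-\nabla_{[X,Y]}Z$.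 *)

theory Defs
  imports "HOL-Analysis.Analysis" "HOL-Library.Function_Algebras"
begin

section \<open>Smooth maps between Euclidean spaces\<close>

text \<open>Only used for open sets \<open>S\<close>; then \<open>Ck_on k S f\<close> is the usual notion of class \<open>C\<^sup>k\<close>,
  expressed through iterated directional derivatives.\<close>

primrec Ck_on :: "nat \<Rightarrow> 'a::euclidean_space set \<Rightarrow> ('a \<Rightarrow> 'b::real_normed_vector) \<Rightarrow> bool" where
  "Ck_on 0 S f \<longleftrightarrow> continuous_on S f"
| "Ck_on (Suc k) S f \<longleftrightarrow>
     (\<forall>x\<in>S. f differentiable (at x)) \<and> (\<forall>v. Ck_on k S (\<lambda>x. frechet_derivative f (at x) v))"

definition smooth_on :: "'a::euclidean_space set \<Rightarrow> ('a \<Rightarrow> 'b::real_normed_vector) \<Rightarrow> bool" where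
  "smooth_on S f \<longleftrightarrow> (\<forall>k. Ck_on k S f)"

section \<open>Smooth manifolds\<close>

text \<open>The underlying space of the manifold is a type \<open>'m\<close> carrying a Hausdorff, second countable
  topology. A chart is a pair of its domain and its coordinate map into the model space \<open>'e\<close>,
  whose dimension is the dimension of the manifold. The atlas need not be maximal.\<close>

type_synonym ('m, 'e) chart = "'m set \<times> ('m \<Rightarrow> 'e)"

definition is_chart :: "('m::topological_space, 'e::euclidean_space) chart \<Rightarrow> bool" where
  "is_chart = (\<lambda>(U, c). open U \<and> open (c ` U) \<and> homeomorphism U (c ` U) c (inv_into U c))"

definition smooth_atlas ::
  "('m::{t2_space,second_countable_topology}, 'e::euclidean_space) chart set \<Rightarrow> bool" where
  "smooth_atlas A \<longleftrightarrow>
     (\<Union>(U, c)\<in>A. U) = UNIV \<and>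
     (\<forall>C\<in>A. is_chart C) \<and>
     (\<forall>(U, c)\<in>A. \<forall>(V, d)\<in>A. smooth_on (c ` (U \<inter> V)) (d \<circ> inv_into U c))"

definition smooth_funs :: "('m, 'e::euclidean_space) chart set \<Rightarrow> ('m \<Rightarrow> real) set" where
  "smooth_funs A = {f. \<forall>(U, c)\<in>A. smooth_on (c ` U) (f \<circ> inv_into U c)}"

section \<open>Tangent vectors, vector fields and tensor fields\<close>

text \<open>Tangent vectors at a point are the derivations at that point of the algebra of smooth
  functions. They are normalised to vanish on functions that are not smooth, so that equality of
  derivations is equality in HOL; the vector space operations are the pointwise ones.\<close>

type_synonym 'm tvec = "('m \<Rightarrow> real) \<Rightarrow> real"
type_synonym 'm vfield = "'m \<Rightarrow> 'm tvec"
type_synonym 'm endo_field = "'m \<Rightarrow> 'm tvec \<Rightarrow> 'm tvec"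
type_synonym 'm form_field = "'m \<Rightarrow> 'm tvec \<Rightarrow> real"
type_synonym 'm bilin_field = "'m \<Rightarrow> 'm tvec \<Rightarrow> 'm tvec \<Rightarrow> real"

definition tangent_space :: "('m, 'e::euclidean_space) chart set \<Rightarrow> 'm \<Rightarrow> 'm tvec set" where
  "tangent_space A p = {v.
     (\<forall>f\<in>smooth_funs A. \<forall>h\<in>smooth_funs A. \<forall>a b. v (\<lambda>q. a * f q + b * h q) = a * v f + b * v h) \<and>
     (\<forall>f\<in>smooth_funs A. \<forall>h\<in>smooth_funs A. v (\<lambda>q. f q * h q) = f p * v h + h p * v f) \<and>
     (\<forall>f. f \<notin> smooth_funs A \<longrightarrow> v f = 0)}"

definition deriv_along :: "'m vfield \<Rightarrow> ('m \<Rightarrow> real) \<Rightarrow> 'm \<Rightarrow> real" where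
  "deriv_along X f = (\<lambda>p. X p f)"

definition vector_fields :: "('m, 'e::euclidean_space) chart set \<Rightarrow> 'm vfield set" where
  "vector_fields A = {X. (\<forall>p. X p \<in> tangent_space A p) \<and>
     (\<forall>f\<in>smooth_funs A. deriv_along X f \<in> smooth_funs A)}"

definition fun_smult :: "('m \<Rightarrow> real) \<Rightarrow> 'm vfield \<Rightarrow> 'm vfield" (infixr \<open>*\<^sub>V\<close> 75) where
  "h *\<^sub>V X = (\<lambda>p f. h p * X p f)"

definition lie_bracket :: "'m vfield \<Rightarrow> 'm vfield \<Rightarrow> 'm vfield" where
  "lie_bracket X Y = (\<lambda>p f. X p (deriv_along Y f) - Y p (deriv_along X f))"

definition endo_app :: "'m endo_field \<Rightarrow> 'm vfield \<Rightarrow> 'm vfield" where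
  "endo_app F X = (\<lambda>p. F p (X p))"

definition form_app :: "'m form_field \<Rightarrow> 'm vfield \<Rightarrow> 'm \<Rightarrow> real" where
  "form_app \<omega> X = (\<lambda>p. \<omega> p (X p))"

definition bilin_app :: "'m bilin_field \<Rightarrow> 'm vfield \<Rightarrow> 'm vfield \<Rightarrow> 'm \<Rightarrow> real" where
  "bilin_app g X Y = (\<lambda>p. g p (X p) (Y p))"

text \<open>Tensor fields are pointwise multilinear maps on tangent spaces; they are smooth iff they
  send smooth vector fields to smooth vector fields or functions. Their values on arguments that
  are not tangent vectors are irrelevant.\<close>

definition endo_tensor :: "('m, 'e::euclidean_space) chart set \<Rightarrow> 'm endo_field \<Rightarrow> bool" where
  "endo_tensor A F \<longleftrightarrow>
     (\<forall>p. \<forall>v\<in>tangent_space A p. F p v \<in> tangent_space A p) \<and>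
     (\<forall>p. \<forall>v\<in>tangent_space A p. \<forall>w\<in>tangent_space A p. \<forall>a b.
        F p (\<lambda>f. a * v f + b * w f) = (\<lambda>f. a * F p v f + b * F p w f)) \<and>
     (\<forall>X\<in>vector_fields A. endo_app F X \<in> vector_fields A)"

definition nonsingular_endo :: "('m, 'e::euclidean_space) chart set \<Rightarrow> 'm endo_field \<Rightarrow> bool" where
  "nonsingular_endo A F \<longleftrightarrow> (\<forall>p. bij_betw (F p) (tangent_space A p) (tangent_space A p))"

definition one_form :: "('m, 'e::euclidean_space) chart set \<Rightarrow> 'm form_field \<Rightarrow> bool" where
  "one_form A \<omega> \<longleftrightarrow>
     (\<forall>p. \<forall>v\<in>tangent_space A p. \<forall>w\<in>tangent_space A p. \<forall>a b.
        \<omega> p (\<lambda>f. a * v f + b * w f) = a * \<omega> p v + b * \<omega> p w) \<and>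
     (\<forall>X\<in>vector_fields A. form_app \<omega> X \<in> smooth_funs A)"

definition riemannian_metric :: "('m, 'e::euclidean_space) chart set \<Rightarrow> 'm bilin_field \<Rightarrow> bool" where
  "riemannian_metric A g \<longleftrightarrow>
     (\<forall>p. \<forall>u\<in>tangent_space A p. \<forall>v\<in>tangent_space A p. \<forall>w\<in>tangent_space A p. \<forall>a b.
        g p (\<lambda>f. a * u f + b * v f) w = a * g p u w + b * g p v w) \<and>
     (\<forall>p. \<forall>v\<in>tangent_space A p. \<forall>w\<in>tangent_space A p. g p v w = g p w v) \<and>
     (\<forall>p. \<forall>v\<in>tangent_space A p. v \<noteq> 0 \<longrightarrow> g p v v > 0) \<and>
     (\<forall>X\<in>vector_fields A. \<forall>Y\<in>vector_fields A. bilin_app g X Y \<in> smooth_funs A)"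

section \<open>Levi-Civita connection and curvature\<close>

type_synonym 'm connection = "'m vfield \<Rightarrow> 'm vfield \<Rightarrow> 'm vfield"

definition affine_connection :: "('m, 'e::euclidean_space) chart set \<Rightarrow> 'm connection \<Rightarrow> bool" where
  "affine_connection A D \<longleftrightarrow>
     (\<forall>X\<in>vector_fields A. \<forall>Y\<in>vector_fields A. D X Y \<in> vector_fields A) \<and>
     (\<forall>X\<in>vector_fields A. \<forall>Y\<in>vector_fields A. \<forall>Z\<in>vector_fields A.
        D (X + Y) Z = D X Z + D Y Z \<and> D X (Y + Z) = D X Y + D X Z) \<and>
     (\<forall>h\<in>smooth_funs A. \<forall>X\<in>vector_fields A. \<forall>Y\<in>vector_fields A.
        D (h *\<^sub>V X) Y = h *\<^sub>V D X Y \<and>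
        D X (h *\<^sub>V Y) = deriv_along X h *\<^sub>V Y + h *\<^sub>V D X Y)"

definition levi_civita ::
  "('m, 'e::euclidean_space) chart set \<Rightarrow> 'm bilin_field \<Rightarrow> 'm connection \<Rightarrow> bool" where
  "levi_civita A g D \<longleftrightarrow>
     affine_connection A D \<and>
     (\<forall>X\<in>vector_fields A. \<forall>Y\<in>vector_fields A. D X Y - D Y X = lie_bracket X Y) \<and>
     (\<forall>X\<in>vector_fields A. \<forall>Y\<in>vector_fields A. \<forall>Z\<in>vector_fields A.
        deriv_along X (bilin_app g Y Z) = bilin_app g (D X Y) Z + bilin_app g Y (D X Z))"

definition cov_deriv_endo ::
  "'m connection \<Rightarrow> 'm endo_field \<Rightarrow> 'm vfield \<Rightarrow> 'm vfield \<Rightarrow> 'm vfield" where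
  "cov_deriv_endo D F X Y = D X (endo_app F Y) - endo_app F (D X Y)"

definition curvature :: "'m connection \<Rightarrow> 'm vfield \<Rightarrow> 'm vfield \<Rightarrow> 'm vfield \<Rightarrow> 'm vfield" where
  "curvature D X Y Z = D X (D Y Z) - D Y (D X Z) - D (lie_bracket X Y) Z"

section \<open>Weak almost contact metric and weak nearly Sasakian structures\<close>

definition kernel_fields ::
  "('m, 'e::euclidean_space) chart set \<Rightarrow> 'm form_field \<Rightarrow> 'm vfield set" where
  "kernel_fields A \<eta> = {X \<in> vector_fields A. \<forall>p. \<eta> p (X p) = 0}"

definition weak_almost_contact_metric ::
  "('m, 'e::euclidean_space) chart set \<Rightarrow> 'm endo_field \<Rightarrow> 'm endo_field \<Rightarrow> 'm vfield \<Rightarrow>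
   'm form_field \<Rightarrow> 'm bilin_field \<Rightarrow> bool" where
  "weak_almost_contact_metric A \<phi> Q \<xi> \<eta> g \<longleftrightarrow>
     endo_tensor A \<phi> \<and> endo_tensor A Q \<and> nonsingular_endo A Q \<and>
     \<xi> \<in> vector_fields A \<and> one_form A \<eta> \<and> riemannian_metric A g \<and>
     (\<forall>p. \<forall>v\<in>tangent_space A p. \<phi> p (\<phi> p v) = (\<lambda>f. - Q p v f + \<eta> p v * \<xi> p f)) \<and>
     (\<forall>p. \<eta> p (\<xi> p) = 1) \<and>
     (\<forall>p. Q p (\<xi> p) = \<xi> p) \<and>
     (\<forall>p. \<forall>v\<in>tangent_space A p. \<eta> p v = 0 \<longrightarrow> \<eta> p (\<phi> p v) = 0) \<and>
     (\<forall>X\<in>vector_fields A. \<forall>Y\<in>vector_fields A.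
        bilin_app g (endo_app \<phi> X) (endo_app \<phi> Y) =
        bilin_app g X (endo_app Q Y) - form_app \<eta> X * form_app \<eta> Y)"

definition weak_nearly_sasakian ::
  "('m, 'e::euclidean_space) chart set \<Rightarrow> 'm connection \<Rightarrow> 'm endo_field \<Rightarrow> 'm endo_field \<Rightarrow>
   'm vfield \<Rightarrow> 'm form_field \<Rightarrow> 'm bilin_field \<Rightarrow> bool" where
  "weak_nearly_sasakian A D \<phi> Q \<xi> \<eta> g \<longleftrightarrow>
     weak_almost_contact_metric A \<phi> Q \<xi> \<eta> g \<and> levi_civita A g D \<and>
     (\<forall>Y\<in>vector_fields A. \<forall>Z\<in>vector_fields A.
        cov_deriv_endo D \<phi> Y Z + cov_deriv_endo D \<phi> Z Y =
        (\<lambda>p. 2 * g p (Y p) (Z p)) *\<^sub>V \<xi> - form_app \<eta> Z *\<^sub>V Y - form_app \<eta> Y *\<^sub>V Z)"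

definition Q_tilde :: "'m endo_field \<Rightarrow> 'm endo_field" where
  "Q_tilde Q = (\<lambda>p v. Q p v - v)"

definition curvature_invariant ::
  "('m, 'e::euclidean_space) chart set \<Rightarrow> 'm connection \<Rightarrow> 'm form_field \<Rightarrow> bool" where
  "curvature_invariant A D \<eta> \<longleftrightarrow>
     (\<forall>X\<in>kernel_fields A \<eta>. \<forall>Y\<in>kernel_fields A \<eta>. \<forall>Z\<in>kernel_fields A \<eta>.
        curvature D X Y Z \<in> kernel_fields A \<eta>)"

end

theory Submission
  imports Defs
begin

text \<open>Pairing condition (i) with \<open>\<xi>\<close> shows that \<open>Q - id\<close> annihilates the range of \<open>\<nabla>\<xi>\<close>, and
  differentiating \<open>\<phi>\<^sup>2 = - Q + \<eta> \<otimes> \<xi>\<close> along \<open>\<xi>\<close> gives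
  \<open>\<phi> (\<nabla>\<^bsub>X\<^esub>\<xi>) + \<nabla>\<^bsub>\<phi>X\<^esub>\<xi> = 2X\<close> on \<open>ker \<eta>\<close>. Together these force \<open>Q = id\<close>, so the structure is nearly
  Sasakian. Then \<open>\<xi>\<close> is Killing and \<open>g(R\<^bsub>X,\<xi>\<^esub>Y, Z) = g((\<nabla>\<^bsub>X\<^esub>\<nabla>\<xi>)Y, Z)\<close>. On \<open>ker \<eta>\<close> the form
  \<open>c(X, Y, Z) = g((\<nabla>\<^bsub>X\<^esub>\<phi>)Y, Z)\<close> is totally skew, and \<open>h = \<nabla>\<xi> + \<phi>\<close> anticommutes with \<open>\<phi>\<close>. The Ricci
  identity for \<open>\<phi>\<close> makes \<open>t(X, Y, Z) = g(R\<^bsub>X,\<xi>\<^esub>Y, \<phi>Z) - c(X, hY, Z)\<close> totally skew as well. The skew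
  symmetry of \<open>R\<close> and the first Bianchi identity then express \<open>t\<close> through \<open>c\<close> and \<open>h\<close>, and the
  compatibility of these expressions forces \<open>c(hX, Y, Z) = 0\<close> and hence the claim.\<close>

section \<open>Smooth functions and vector fields\<close>

text \<open>Since \<open>S\<close> is open, a derivative at a point of \<open>S\<close> sees only
  values on \<open>S\<close>; the induction carries this to all iterated derivatives.\<close>

lemma Ck_on_cong:
  assumes "open S" and "\<And>x. x \<in> S \<Longrightarrow> f x = h x" and "Ck_on k S f"
  shows "Ck_on k S h"
  using assms(2,3)
proof (induction k arbitrary: f h)
  case 0
  then show ?case by (auto cong: continuous_on_cong)
next
  case (Suc k)
  have D: "(h has_derivative frechet_derivative f (at x)) (at x)" if "x \<in> S" for x
    using Suc.prems that \<open>open S\<close>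
    by (auto intro: has_derivative_transform_within_open[of f _ x UNIV S]
        simp: frechet_derivative_works)
  have "Ck_on k S (\<lambda>x. frechet_derivative h (at x) v)" for v
  proof (rule Suc.IH)
    show "frechet_derivative f (at x) v = frechet_derivative h (at x) v" if "x \<in> S" for x
      using frechet_derivative_at[OF D[OF that]] by simp
  qed (use Suc.prems in auto)
  then show ?case
    using D by (auto simp: differentiable_def)
qed

lemma Ck_on_linear_combination:
  fixes f h :: "'a::euclidean_space \<Rightarrow> real"
  assumes "open S" and "Ck_on k S f" and "Ck_on k S h"
  shows "Ck_on k S (\<lambda>x. a * f x + b * h x)"
  using assms(2,3)
proof (induction k arbitrary: f h)
  case 0
  then show ?case by (auto intro!: continuous_intros)
next
  case (Suc k)
  have D: "((\<lambda>x. a * f x + b * h x) has_derivative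
      (\<lambda>v. a * frechet_derivative f (at x) v + b * frechet_derivative h (at x) v)) (at x)"
    if "x \<in> S" for x
    using Suc.prems that by (auto intro!: derivative_eq_intros simp: frechet_derivative_works)
  have "Ck_on k S (\<lambda>x. frechet_derivative (\<lambda>x. a * f x + b * h x) (at x) v)" for v
  \<comment> \<open>The formula for the derivative is known on \<open>S\<close> only, so a
    congruence replaces rewriting.\<close>
  proof (rule Ck_on_cong[OF \<open>open S\<close>])
    show "Ck_on k S (\<lambda>x. a * frechet_derivative f (at x) v + b * frechet_derivative h (at x) v)"
      using Suc by auto
    show "a * frechet_derivative f (at x) v + b * frechet_derivative h (at x) v =
        frechet_derivative (\<lambda>x. a * f x + b * h x) (at x) v" if "x \<in> S" for x
      using frechet_derivative_at[OF D[OF that]] by metis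
  qed
  then show ?case
    using D by (auto simp: differentiable_def)
qed

lemma smooth_funs_linear_combination:
  assumes "smooth_atlas A" and "f \<in> smooth_funs A" and "h \<in> smooth_funs A"
  shows "(\<lambda>q. a * f q + b * h q) \<in> smooth_funs A"
proof -
  have "smooth_on (c ` U) ((\<lambda>q. a * f q + b * h q) \<circ> inv_into U c)" if "(U, c) \<in> A" for U c
  proof -
    have "open (c ` U)"
      using assms(1) that by (auto simp: smooth_atlas_def is_chart_def)
    then show ?thesis
      using assms(2,3) that Ck_on_linear_combination[of "c ` U"]
      by (fastforce simp: smooth_funs_def smooth_on_def comp_def)
  qed
  then show ?thesis by (auto simp: smooth_funs_def)
qed

lemma tangent_space_linear_combination:
  assumes "v \<in> tangent_space A p" and "w \<in> tangent_space A p"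
  shows "(\<lambda>f. a * v f + b * w f) \<in> tangent_space A p"
  using assms by (simp add: tangent_space_def) (auto simp: algebra_simps)

lemma vector_fields_linear_combination:
  assumes "smooth_atlas A" and "X \<in> vector_fields A" and "Y \<in> vector_fields A"
  shows "(\<lambda>p f. a * X p f + b * Y p f) \<in> vector_fields A"
  using assms tangent_space_linear_combination[of _ A]
    smooth_funs_linear_combination[of A "deriv_along X f" "deriv_along Y f" a b for f]
  by (auto simp: vector_fields_def deriv_along_def)

text \<open>Tangent vectors are normalised to vanish on functions that are not smooth, so the smooth
  ones decide equality.\<close>

lemma vector_field_ext:
  assumes "X \<in> vector_fields A" and "Y \<in> vector_fields A"
    and "\<And>p f. f \<in> smooth_funs A \<Longrightarrow> X p f = Y p f"
  shows "X = Y"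
proof (intro ext)
  fix p f
  show "X p f = Y p f"
  proof (cases "f \<in> smooth_funs A")
    case False
    then show ?thesis using assms(1,2) by (simp add: vector_fields_def tangent_space_def)
  qed (rule assms(3))
qed

section \<open>Riemannian geometry in terms of vector fields\<close>

locale riemannian_manifold =
  fixes A :: "('m::{t2_space,second_countable_topology}, 'e::euclidean_space) chart set"
    and g :: "'m bilin_field" and D :: "'m connection"
  assumes atlas: "smooth_atlas A"
    and metric: "riemannian_metric A g"
    and levi_civita: "levi_civita A g D"
begin

abbreviation V where "V \<equiv> vector_fields A"
abbreviation ip where "ip \<equiv> bilin_app g"
abbreviation R where "R \<equiv> curvature D"

lemma tangent: "X \<in> V \<Longrightarrow> X p \<in> tangent_space A p"
  by (simp add: vector_fields_def)

lemma add_V [simp]: "X \<in> V \<Longrightarrow> Y \<in> V \<Longrightarrow> X + Y \<in> V"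
  using vector_fields_linear_combination[OF atlas, of X Y 1 1] by (simp add: plus_fun_def)

lemma diff_V [simp]: "X \<in> V \<Longrightarrow> Y \<in> V \<Longrightarrow> X - Y \<in> V"
  using vector_fields_linear_combination[OF atlas, of X Y 1 "-1"] by (simp add: fun_diff_def)

lemma minus_V [simp]: "X \<in> V \<Longrightarrow> - X \<in> V"
  using vector_fields_linear_combination[OF atlas, of X X "-1" 0] by (simp add: fun_Compl_def)

lemma D_V [simp]: "X \<in> V \<Longrightarrow> Y \<in> V \<Longrightarrow> D X Y \<in> V"
  using levi_civita by (simp add: levi_civita_def affine_connection_def)

lemma ip_smooth [simp]: "X \<in> V \<Longrightarrow> Y \<in> V \<Longrightarrow> ip X Y \<in> smooth_funs A"
  using metric by (simp add: riemannian_metric_def)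

lemma deriv_smooth [simp]: "X \<in> V \<Longrightarrow> f \<in> smooth_funs A \<Longrightarrow> deriv_along X f \<in> smooth_funs A"
  by (simp add: vector_fields_def)

lemma ip_commute: "X \<in> V \<Longrightarrow> Y \<in> V \<Longrightarrow> ip X Y = ip Y X"
  using metric tangent by (auto simp: riemannian_metric_def bilin_app_def)

lemma ip_linear_combination_left:
  assumes "X \<in> V" "Y \<in> V" "Z \<in> V"
  shows "g p (\<lambda>f. a * X p f + b * Y p f) (Z p) = a * ip X Z p + b * ip Y Z p"
  using assms metric tangent by (simp add: riemannian_metric_def bilin_app_def)

lemma ip_add_left [simp]:
  "X \<in> V \<Longrightarrow> Y \<in> V \<Longrightarrow> Z \<in> V \<Longrightarrow> ip (X + Y) Z p = ip X Z p + ip Y Z p"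
  using ip_linear_combination_left[of X Y Z p 1 1] by (simp add: bilin_app_def plus_fun_def)

lemma ip_diff_left [simp]:
  "X \<in> V \<Longrightarrow> Y \<in> V \<Longrightarrow> Z \<in> V \<Longrightarrow> ip (X - Y) Z p = ip X Z p - ip Y Z p"
  using ip_linear_combination_left[of X Y Z p 1 "-1"] by (simp add: bilin_app_def fun_diff_def)

lemma ip_minus_left [simp]: "X \<in> V \<Longrightarrow> Z \<in> V \<Longrightarrow> ip (- X) Z p = - ip X Z p"
  using ip_linear_combination_left[of X X Z p "-1" 0] by (simp add: bilin_app_def fun_Compl_def)

lemma ip_add_right [simp]:
  "X \<in> V \<Longrightarrow> Y \<in> V \<Longrightarrow> Z \<in> V \<Longrightarrow> ip Z (X + Y) p = ip Z X p + ip Z Y p"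
  using ip_commute[of Z] by simp

lemma ip_diff_right [simp]:
  "X \<in> V \<Longrightarrow> Y \<in> V \<Longrightarrow> Z \<in> V \<Longrightarrow> ip Z (X - Y) p = ip Z X p - ip Z Y p"
  using ip_commute[of Z] by simp

lemma ip_minus_right [simp]: "X \<in> V \<Longrightarrow> Z \<in> V \<Longrightarrow> ip Z (- X) p = - ip Z X p"
  using ip_commute[of Z] by simp

lemma zero_V [simp]: "0 \<in> V"
proof -
  have "(\<lambda>q. 0) \<in> smooth_funs A" if "f \<in> smooth_funs A" for f
    using smooth_funs_linear_combination[OF atlas that that, of 0 0] by simp
  then show ?thesis
    by (auto simp: vector_fields_def tangent_space_def deriv_along_def)
qed

lemma ip_zero_left [simp]: "Z \<in> V \<Longrightarrow> ip 0 Z p = 0"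
  using ip_diff_left[of Z Z Z p] by simp

lemma ip_smult_left:
  assumes "X \<in> V" "Y \<in> V"
  shows "ip (h *\<^sub>V X) Y p = h p * ip X Y p"
  using ip_linear_combination_left[OF assms(1) assms, of p "h p" 0]
  by (simp add: bilin_app_def fun_smult_def)

lemma ip_self_eq_0:
  assumes "X \<in> V" and "\<And>p. ip X X p = 0"
  shows "X = 0"
proof
  fix p
  have "\<not> g p (X p) (X p) > 0"
    using assms(2)[of p] by (simp add: bilin_app_def)
  then have "X p = 0"
    using tangent[OF assms(1), of p] metric unfolding riemannian_metric_def by blast
  then show "X p = 0 p" by simp
qed

lemma D_add [simp]:
  "X \<in> V \<Longrightarrow> Y \<in> V \<Longrightarrow> Z \<in> V \<Longrightarrow> D (X + Y) Z = D X Z + D Y Z"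
  "X \<in> V \<Longrightarrow> Y \<in> V \<Longrightarrow> Z \<in> V \<Longrightarrow> D X (Y + Z) = D X Y + D X Z"
  using levi_civita by (simp_all add: levi_civita_def affine_connection_def)

lemma D_diff [simp]:
  assumes "X \<in> V" "Y \<in> V" "Z \<in> V"
  shows "D (X - Y) Z = D X Z - D Y Z" and "D X (Y - Z) = D X Y - D X Z"
  using D_add(1)[of "X - Y" Y Z] D_add(2)[of X "Y - Z" Z] assms by simp_all

lemma D_zero [simp]: "X \<in> V \<Longrightarrow> D X 0 = 0" "X \<in> V \<Longrightarrow> D 0 X = 0"
  using D_diff[of X X X] by simp_all

lemma D_minus [simp]:
  assumes "X \<in> V" "Y \<in> V"
  shows "D (- X) Y = - D X Y" and "D X (- Y) = - D X Y"
  using D_diff(1)[of 0 X Y] D_diff(2)[of X 0 Y] assms by simp_all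

lemma smult_zero: "h *\<^sub>V (0 :: 'm vfield) = 0"
  by (simp add: fun_smult_def zero_fun_def)

lemma D_smult:
  "h \<in> smooth_funs A \<Longrightarrow> X \<in> V \<Longrightarrow> Y \<in> V \<Longrightarrow> D (h *\<^sub>V X) Y = h *\<^sub>V D X Y"
  using levi_civita by (simp add: levi_civita_def affine_connection_def)

lemma torsion_free: "X \<in> V \<Longrightarrow> Y \<in> V \<Longrightarrow> lie_bracket X Y = D X Y - D Y X"
  using levi_civita by (simp add: levi_civita_def)

lemma lie_bracket_V [simp]: "X \<in> V \<Longrightarrow> Y \<in> V \<Longrightarrow> lie_bracket X Y \<in> V"
  by (simp add: torsion_free)

lemma deriv_ip:
  "X \<in> V \<Longrightarrow> Y \<in> V \<Longrightarrow> Z \<in> V \<Longrightarrow>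
    deriv_along X (ip Y Z) p = ip (D X Y) Z p + ip Y (D X Z) p"
  using levi_civita by (simp add: levi_civita_def)

lemma deriv_linear_combination:
  "X \<in> V \<Longrightarrow> f \<in> smooth_funs A \<Longrightarrow> h \<in> smooth_funs A \<Longrightarrow>
    X p (\<lambda>q. a * f q + b * h q) = a * X p f + b * X p h"
  using tangent by (simp add: tangent_space_def)

lemma deriv_add:
  "X \<in> V \<Longrightarrow> f \<in> smooth_funs A \<Longrightarrow> h \<in> smooth_funs A \<Longrightarrow> X p (\<lambda>q. f q + h q) = X p f + X p h"
  using deriv_linear_combination[of X f h p 1 1] by simp

lemma deriv_diff:
  "X \<in> V \<Longrightarrow> f \<in> smooth_funs A \<Longrightarrow> h \<in> smooth_funs A \<Longrightarrow> X p (\<lambda>q. f q - h q) = X p f - X p h"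
  using deriv_linear_combination[of X f h p 1 "-1"] by simp

lemma deriv_zero: "X \<in> V \<Longrightarrow> X p (\<lambda>q. 0) = 0"
  using deriv_diff[of X "ip X X" "ip X X" p] by simp

lemma deriv_mult:
  "X \<in> V \<Longrightarrow> f \<in> smooth_funs A \<Longrightarrow> h \<in> smooth_funs A \<Longrightarrow>
    X p (\<lambda>q. f q * h q) = f p * X p h + h p * X p f"
  using tangent[of X p] unfolding tangent_space_def by blast

lemma deriv_minus: "X \<in> V \<Longrightarrow> f \<in> smooth_funs A \<Longrightarrow> deriv_along X (\<lambda>q. - f q) p = - deriv_along X f p"
  using deriv_linear_combination[of X f f p "-1" 0] by (simp add: deriv_along_def)

text \<open>Product rule on both sides of a skew-symmetry identity. It passes the skew symmetries of
  \<phi>, \<open>al\<close> and \<open>G\<close> on to their covariant derivatives.\<close>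

lemma deriv_ip_skew:
  assumes "X \<in> V" "Y \<in> V" "Z \<in> V" "Y' \<in> V" "Z' \<in> V"
    and "\<And>p. ip Y Z p = - ip Y' Z' p"
  shows "ip (D X Y) Z p + ip Y (D X Z) p = - ip (D X Y') Z' p - ip Y' (D X Z') p"
proof -
  have "ip Y Z = (\<lambda>q. - ip Y' Z' q)"
    using assms(6) by auto
  then have "deriv_along X (ip Y Z) p = - deriv_along X (ip Y' Z') p"
    using assms by (simp add: deriv_minus)
  then show ?thesis
    using assms by (simp add: deriv_ip)
qed

lemma ip_D_orthogonal:
  assumes "X \<in> V" "Y \<in> V" "Z \<in> V" "\<And>p. ip Y Z p = 0"
  shows "ip (D X Y) Z p = - ip Y (D X Z) p"
proof -
  have "ip Y Z = (\<lambda>p. 0)"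
    using assms(4) by auto
  then have "deriv_along X (ip Y Z) p = 0"
    using assms by (simp add: deriv_along_def deriv_zero)
  then show ?thesis
    using deriv_ip[OF assms(1-3), of p] by simp
qed

section \<open>Symmetries of the curvature tensor\<close>

lemma curvature_V [simp]: "X \<in> V \<Longrightarrow> Y \<in> V \<Longrightarrow> Z \<in> V \<Longrightarrow> R X Y Z \<in> V"
  by (simp add: curvature_def)

lemma curvature_swap: "X \<in> V \<Longrightarrow> Y \<in> V \<Longrightarrow> Z \<in> V \<Longrightarrow> R X Y Z = - R Y X Z"
  by (simp add: curvature_def torsion_free)

lemma jacobi:
  assumes "X \<in> V" "Y \<in> V" "Z \<in> V"
  shows "lie_bracket X (lie_bracket Y Z) + lie_bracket Y (lie_bracket Z X)
    + lie_bracket Z (lie_bracket X Y) = 0"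
proof (rule vector_field_ext)
  fix p f
  assume f: "f \<in> smooth_funs A"
  \<comment> \<open>A derivation is linear, so a double bracket expands into four third-order terms;
    in the cyclic sum all of them cancel.\<close>
  have *: "lie_bracket X (lie_bracket Y Z) p f =
      X p (deriv_along Y (deriv_along Z f)) - X p (deriv_along Z (deriv_along Y f))
      - (Y p (deriv_along Z (deriv_along X f)) - Z p (deriv_along Y (deriv_along X f)))"
    if "X \<in> V" "Y \<in> V" "Z \<in> V" for X Y Z
  proof -
    have "deriv_along (lie_bracket Y Z) f =
        (\<lambda>q. deriv_along Y (deriv_along Z f) q - deriv_along Z (deriv_along Y f) q)"
      by (simp add: deriv_along_def lie_bracket_def)
    then show ?thesis
      using that f by (simp add: lie_bracket_def deriv_diff)
  qed
  show "(lie_bracket X (lie_bracket Y Z) + lie_bracket Y (lie_bracket Z X)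
      + lie_bracket Z (lie_bracket X Y)) p f = 0 p f"
    using assms by (simp add: *)
qed (use assms in simp_all)

text \<open>Without torsion the cyclic sum regroups into differences of
  \<open>D X (lie_bracket Y Z)\<close> and \<open>D (lie_bracket Y Z) X\<close>, that is, into
  double brackets, and Jacobi applies.\<close>

lemma bianchi:
  assumes "X \<in> V" "Y \<in> V" "Z \<in> V"
  shows "R X Y Z + R Y Z X + R Z X Y = 0"
  using jacobi[OF assms] assms by (simp add: curvature_def torsion_free algebra_simps)

text \<open>Expand [X,Y]f = XYf - YXf for f = g(Z,W): the mixed terms of XYf are symmetric in X and
  Y and cancel.\<close>

lemma ip_curvature_skew:
  assumes "X \<in> V" "Y \<in> V" "Z \<in> V" "W \<in> V"
  shows "ip (R X Y Z) W p = - ip (R X Y W) Z p"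
proof -
  have *: "deriv_along X (deriv_along Y (ip Z W)) p =
      ip (D X (D Y Z)) W p + ip (D Y Z) (D X W) p + ip (D X Z) (D Y W) p + ip Z (D X (D Y W)) p"
    if "X \<in> V" "Y \<in> V" for X Y
  proof -
    have "deriv_along Y (ip Z W) = (\<lambda>q. ip (D Y Z) W q + ip Z (D Y W) q)"
      using assms that by (simp add: deriv_ip fun_eq_iff)
    then have "deriv_along X (deriv_along Y (ip Z W)) p =
        deriv_along X (ip (D Y Z) W) p + deriv_along X (ip Z (D Y W)) p"
      using assms that by (simp add: deriv_along_def deriv_add)
    then show ?thesis
      using assms that by (simp add: deriv_ip)
  qed
  have "deriv_along (lie_bracket X Y) (ip Z W) p =
      deriv_along X (deriv_along Y (ip Z W)) p - deriv_along Y (deriv_along X (ip Z W)) p"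
    by (simp add: deriv_along_def lie_bracket_def)
  then have "ip (D (lie_bracket X Y) Z) W p + ip Z (D (lie_bracket X Y) W) p =
      ip (D X (D Y Z)) W p + ip Z (D X (D Y W)) p
      - ip (D Y (D X Z)) W p - ip Z (D Y (D X W)) p"
    using assms by (simp add: * deriv_ip del: D_diff D_add)
  then have "ip (R X Y Z) W p + ip Z (R X Y W) p = 0"
    using assms by (simp add: curvature_def)
  then show ?thesis
    using assms ip_commute[of Z "R X Y W"] by simp
qed

lemma ip_curvature_swap:
  "X \<in> V \<Longrightarrow> Y \<in> V \<Longrightarrow> Z \<in> V \<Longrightarrow> W \<in> V \<Longrightarrow> ip (R X Y Z) W p = - ip (R Y X Z) W p"
  using curvature_swap[of X Y Z] by simp

lemma ip_bianchi:
  assumes "X \<in> V" "Y \<in> V" "Z \<in> V" "W \<in> V"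
  shows "ip (R X Y Z) W p + ip (R Y Z X) W p + ip (R Z X Y) W p = 0"
proof -
  have "ip (R X Y Z + R Y Z X + R Z X Y) W p = 0"
    using bianchi assms by simp
  then show ?thesis using assms by simp
qed

text \<open>The octahedron argument: four Bianchi identities, one for each rotation of the
  arguments, combined with both skew symmetries.\<close>

lemma ip_curvature_pair_symmetric:
  assumes "X \<in> V" "Y \<in> V" "Z \<in> V" "W \<in> V"
  shows "ip (R X Y Z) W p = ip (R Z W X) Y p"
  using ip_bianchi[OF assms, of p] ip_bianchi[OF assms(2,3,4,1), of p]
    ip_bianchi[OF assms(3,4,1,2), of p] ip_bianchi[OF assms(4,1,2,3), of p]
    ip_curvature_skew[OF assms(2,3,4,1), of p] ip_curvature_skew[OF assms(3,4,2,1), of p]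
    ip_curvature_skew[OF assms(1,4,3,2), of p] ip_curvature_skew[OF assms(3,1,4,2), of p]
    ip_curvature_skew[OF assms(1,2,4,3), of p] ip_curvature_skew[OF assms(2,4,1,3), of p]
    ip_curvature_swap[OF assms(4,2,3,1), of p] ip_curvature_swap[OF assms(4,1,3,2), of p]
    ip_curvature_swap[OF assms(1,3,4,2), of p] ip_curvature_swap[OF assms(4,1,2,3), of p]
  by linarith

end


section \<open>Weak nearly Sasakian structures\<close>

locale parallel_weak_nearly_sasakian =
  fixes A :: "('m::{t2_space,second_countable_topology}, 'e::euclidean_space) chart set"
    and \<phi> Q :: "'m endo_field" and \<xi> :: "'m vfield" and \<eta> :: "'m form_field"
    and g :: "'m bilin_field" and D :: "'m connection"
  assumes smooth_atlas: "smooth_atlas A"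
    and weak_nearly_sasakian: "weak_nearly_sasakian A D \<phi> Q \<xi> \<eta> g"
    and Q_tilde_parallel:
      "\<And>X Y. X \<in> vector_fields A \<Longrightarrow> Y \<in> kernel_fields A \<eta> \<Longrightarrow> cov_deriv_endo D (Q_tilde Q) X Y = 0"
begin

lemma contact_metric: "weak_almost_contact_metric A \<phi> Q \<xi> \<eta> g"
  using weak_nearly_sasakian by (simp add: weak_nearly_sasakian_def)

sublocale riemannian_manifold A g D
  using smooth_atlas weak_nearly_sasakian contact_metric
  by unfold_locales (simp_all add: weak_nearly_sasakian_def weak_almost_contact_metric_def)

abbreviation H where "H \<equiv> kernel_fields A \<eta>"
abbreviation ph where "ph \<equiv> endo_app \<phi>"
abbreviation q where "q \<equiv> endo_app Q"
abbreviation al where "al X \<equiv> D X \<xi>"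
abbreviation G where "G \<equiv> cov_deriv_endo D \<phi>"
abbreviation vert where "vert X \<equiv> form_app \<eta> X *\<^sub>V \<xi>"

section \<open>Algebra of \<phi>, Q, \<xi>, \<eta> and the metric\<close>

lemma endo_tensors: "endo_tensor A \<phi>" "endo_tensor A Q"
  using contact_metric by (simp_all add: weak_almost_contact_metric_def)

lemma xi_V [simp]: "\<xi> \<in> V"
  using contact_metric by (simp add: weak_almost_contact_metric_def)

lemma H_V [simp]: "X \<in> H \<Longrightarrow> X \<in> V"
  by (simp add: kernel_fields_def)

lemma endo_V: "endo_tensor A F \<Longrightarrow> X \<in> V \<Longrightarrow> endo_app F X \<in> V"
  by (simp add: endo_tensor_def)

lemma endo_linear_combination:
  assumes "endo_tensor A F" "X \<in> V" "Y \<in> V"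
  shows "F p (\<lambda>f. a * X p f + b * Y p f) = (\<lambda>f. a * F p (X p) f + b * F p (Y p) f)"
  using assms tangent by (simp add: endo_tensor_def)

lemma endo_add:
  assumes "endo_tensor A F" "X \<in> V" "Y \<in> V"
  shows "endo_app F (X + Y) = endo_app F X + endo_app F Y"
  using endo_linear_combination[OF assms, of _ 1 1] by (simp add: endo_app_def plus_fun_def)

lemma endo_diff:
  assumes "endo_tensor A F" "X \<in> V" "Y \<in> V"
  shows "endo_app F (X - Y) = endo_app F X - endo_app F Y"
  using endo_linear_combination[OF assms, of _ 1 "-1"] by (simp add: endo_app_def fun_diff_def)

lemma endo_minus:
  assumes "endo_tensor A F" "X \<in> V"
  shows "endo_app F (- X) = - endo_app F X"
  using endo_linear_combination[OF assms assms(2), of _ "-1" 0]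
  by (simp add: endo_app_def fun_Compl_def)

lemma endo_smult:
  assumes "endo_tensor A F" "X \<in> V"
  shows "endo_app F (h *\<^sub>V X) = h *\<^sub>V endo_app F X"
  using endo_linear_combination[OF assms assms(2), of p "h p" 0 for p]
  by (simp add: endo_app_def fun_smult_def)

lemmas endo_simps [simp] =
  endo_V[OF endo_tensors(1)] endo_V[OF endo_tensors(2)]
  endo_add[OF endo_tensors(1)] endo_add[OF endo_tensors(2)]
  endo_diff[OF endo_tensors(1)] endo_diff[OF endo_tensors(2)]
  endo_minus[OF endo_tensors(1)] endo_minus[OF endo_tensors(2)]
  endo_smult[OF endo_tensors(1)] endo_smult[OF endo_tensors(2)]

lemma ph_zero [simp]: "ph 0 = 0" and q_zero [simp]: "q 0 = 0"
  using endo_simps(5)[of 0 0] endo_simps(6)[of 0 0] by simp_all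

lemma G_V [simp]: "X \<in> V \<Longrightarrow> Y \<in> V \<Longrightarrow> G X Y \<in> V"
  by (simp add: cov_deriv_endo_def)

lemma ph_ph: "X \<in> V \<Longrightarrow> ph (ph X) = vert X - q X"
  using contact_metric tangent
  by (simp add: weak_almost_contact_metric_def endo_app_def fun_smult_def form_app_def
      fun_eq_iff fun_diff_def)

text \<open>Smoothness is read off from the structure equation, which writes \<open>vert X\<close>
  as \<open>ph (ph X) + q X\<close>.\<close>

lemma vert_V [simp]:
  assumes "X \<in> V"
  shows "vert X \<in> V"
proof -
  have "vert X = ph (ph X) + q X"
    using assms by (simp add: ph_ph)
  then show ?thesis
    using assms by (simp only: add_V endo_simps)
qed

lemma q_xi [simp]: "q \<xi> = \<xi>"
  using contact_metric by (simp add: weak_almost_contact_metric_def endo_app_def)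

lemma eta_xi: "form_app \<eta> \<xi> = (\<lambda>p. 1)"
  using contact_metric by (simp add: weak_almost_contact_metric_def form_app_def)

lemma vert_xi [simp]: "vert \<xi> = \<xi>"
  by (simp add: eta_xi fun_smult_def)

lemma q_inj:
  assumes "X \<in> V" "Y \<in> V" "q X = q Y"
  shows "X = Y"
proof
  fix p
  have "Q p (X p) = Q p (Y p)"
    using assms(3) by (metis endo_app_def)
  moreover have "inj_on (Q p) (tangent_space A p)"
    using contact_metric
    by (auto simp: weak_almost_contact_metric_def nonsingular_endo_def bij_betw_def)
  ultimately show "X p = Y p"
    using assms tangent by (auto dest: inj_onD)
qed

lemma eta_smooth: "X \<in> V \<Longrightarrow> form_app \<eta> X \<in> smooth_funs A"
  using contact_metric by (simp add: weak_almost_contact_metric_def one_form_def)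

lemma eta_linear_combination:
  assumes "X \<in> V" "Y \<in> V"
  shows "\<eta> p (\<lambda>f. a * X p f + b * Y p f) = a * form_app \<eta> X p + b * form_app \<eta> Y p"
  using contact_metric tangent assms
  by (simp add: weak_almost_contact_metric_def one_form_def form_app_def)

lemma eta_smult: "X \<in> V \<Longrightarrow> form_app \<eta> (h *\<^sub>V X) p = h p * form_app \<eta> X p"
  using eta_linear_combination[of X X p "h p" 0] by (simp add: form_app_def fun_smult_def)

lemma eta_diff: "X \<in> V \<Longrightarrow> Y \<in> V \<Longrightarrow> form_app \<eta> (X - Y) p = form_app \<eta> X p - form_app \<eta> Y p"
  using eta_linear_combination[of X Y p 1 "-1"] by (simp add: form_app_def fun_diff_def)

lemma eta_zero: "form_app \<eta> 0 p = 0"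
  using eta_diff[of \<xi> \<xi>] by simp

text \<open>The structure equation at \<phi>\<xi> gives Q\<phi>\<xi> = \<open>h\<close>\<xi> with
  \<open>h\<close> = \<eta>(\<phi>\<xi>). As Q is injective and fixes \<xi>, \<phi>\<xi> =
  \<open>h\<close>\<xi>; one more \<phi> yields \<open>h\<close>^2 = 0.\<close>

lemma ph_xi [simp]: "ph \<xi> = 0"
proof -
  define h where "h = form_app \<eta> (ph \<xi>)"
  have 0: "ph (ph \<xi>) = 0"
    by (simp add: ph_ph)
  then have "h *\<^sub>V \<xi> = q (ph \<xi>)" and hV: "h *\<^sub>V \<xi> \<in> V"
    using ph_ph[of "ph \<xi>"] vert_V[of "ph \<xi>"] by (simp_all add: h_def)
  moreover have "q (h *\<^sub>V \<xi>) = h *\<^sub>V \<xi>"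
    by simp
  ultimately have eq: "ph \<xi> = h *\<^sub>V \<xi>"
    using q_inj[OF _ hV, of "ph \<xi>"] endo_simps(1) xi_V by metis
  have "h *\<^sub>V (h *\<^sub>V \<xi>) = 0"
    using 0 by (simp add: eq)
  then have "form_app \<eta> (h *\<^sub>V (h *\<^sub>V \<xi>)) p = 0" for p
    by (simp add: eta_zero)
  then have "h p = 0" for p
    using hV by (simp add: eta_smult eta_xi)
  then show ?thesis
    by (simp add: eq fun_smult_def zero_fun_def)
qed

text \<open>The axiom speaks of ker \<eta> only; since \<phi>\<xi> = 0, X may be replaced by its
  horizontal part.\<close>

lemma eta_ph [simp]:
  assumes X: "X \<in> V"
  shows "form_app \<eta> (ph X) p = 0"
proof -
  let ?Y = "X - vert X"
  have "form_app \<eta> ?Y p = 0"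
    using X by (simp add: eta_diff eta_smult eta_xi)
  moreover have "?Y \<in> V"
    using X by simp
  then have "?Y p \<in> tangent_space A p"
    by (rule tangent)
  ultimately have "form_app \<eta> (ph ?Y) p = 0"
    using contact_metric unfolding weak_almost_contact_metric_def form_app_def endo_app_def
    by blast
  moreover have "ph ?Y = ph X"
    using X by (simp add: smult_zero)
  ultimately show ?thesis by simp
qed

lemma ip_ph_ph:
  "X \<in> V \<Longrightarrow> Y \<in> V \<Longrightarrow> ip (ph X) (ph Y) p = ip X (q Y) p - form_app \<eta> X p * form_app \<eta> Y p"
  using contact_metric by (simp add: weak_almost_contact_metric_def)

lemma ip_q: "X \<in> V \<Longrightarrow> Y \<in> V \<Longrightarrow> ip (q X) Y p = ip X (q Y) p"
  using ip_ph_ph[of X Y p] ip_ph_ph[of Y X p] ip_commute[of "ph X" "ph Y"] ip_commute[of "q X" Y]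
  by simp

lemma ip_xi: "X \<in> V \<Longrightarrow> ip X \<xi> p = form_app \<eta> X p"
  using ip_ph_ph[of X \<xi> p] by (simp add: eta_xi ip_commute[of _ 0])

lemma H_iff: "X \<in> H \<longleftrightarrow> X \<in> V \<and> (\<forall>p. ip X \<xi> p = 0)"
  using ip_xi by (auto simp: kernel_fields_def form_app_def simp del: H_V)

lemma H_I: "X \<in> V \<Longrightarrow> (\<And>p. ip X \<xi> p = 0) \<Longrightarrow> X \<in> H"
  using H_iff by blast

lemma H_xi [simp]: "X \<in> H \<Longrightarrow> ip X \<xi> p = 0" "X \<in> H \<Longrightarrow> ip \<xi> X p = 0"
  using ip_commute[of X \<xi>] H_iff[of X] by (metis xi_V)+

lemma eta_H [simp]: "X \<in> H \<Longrightarrow> form_app \<eta> X p = 0"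
  using ip_xi[of X p] by simp

lemma vert_H: "X \<in> H \<Longrightarrow> vert X = 0"
  by (simp add: fun_smult_def zero_fun_def)

lemma H_closed [simp]:
  "X \<in> H \<Longrightarrow> Y \<in> H \<Longrightarrow> X + Y \<in> H" "X \<in> H \<Longrightarrow> Y \<in> H \<Longrightarrow> X - Y \<in> H" "X \<in> H \<Longrightarrow> - X \<in> H"
  by (rule H_I; simp)+

lemma ph_H [simp]: "X \<in> V \<Longrightarrow> ph X \<in> H"
  by (rule H_I) (simp_all add: ip_xi)

lemma q_H [simp]: "X \<in> H \<Longrightarrow> q X \<in> H"
  by (rule H_I) (simp_all add: ip_q)

lemma horizontal_part [simp]: "X \<in> V \<Longrightarrow> X - vert X \<in> H"
  by (rule H_I) (simp_all add: ip_xi eta_diff eta_smult eta_xi)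

lemma ph_inj:
  assumes "X \<in> H" "ph X = 0"
  shows "X = 0"
  using ph_ph[of X] q_inj[of X 0] assms by (simp add: vert_H)

section \<open>First properties of \<nabla>\<xi>\<close>

lemma al_H [simp]: "X \<in> V \<Longrightarrow> al X \<in> H"
proof -
  assume X: "X \<in> V"
  have one: "ip \<xi> \<xi> = (\<lambda>p. 1)"
    by (simp add: fun_eq_iff ip_xi eta_xi)
  then have "(\<lambda>p. 1) \<in> smooth_funs A"
    using ip_smooth[of \<xi> \<xi>] by simp
  \<comment> \<open>A derivation kills the constant 1 because 1 = 1 * 1; so |\<xi>| = 1 makes
    \<open>al X\<close> orthogonal to \<xi>.\<close>
  then have "X p (\<lambda>q. 1 * 1) = 1 * X p (\<lambda>q. 1) + 1 * X p (\<lambda>q. 1)" for p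
    using X deriv_mult[of X "\<lambda>q. 1" "\<lambda>q. 1"] by blast
  then have "deriv_along X (ip \<xi> \<xi>) p = 0" for p
    by (simp add: one deriv_along_def)
  then show ?thesis
    using X deriv_ip[of X \<xi> \<xi>] ip_commute[of \<xi> "al X"] by (intro H_I) simp_all
qed

lemma nearly_sasakian:
  "X \<in> V \<Longrightarrow> Y \<in> V \<Longrightarrow>
    G X Y + G Y X = (\<lambda>p. 2 * ip X Y p) *\<^sub>V \<xi> - form_app \<eta> Y *\<^sub>V X - form_app \<eta> X *\<^sub>V Y"
  using weak_nearly_sasakian by (simp add: weak_nearly_sasakian_def bilin_app_def)

lemma G_xi_right: "X \<in> V \<Longrightarrow> G X \<xi> = - ph (al X)"
  by (simp add: cov_deriv_endo_def)

lemma al_xi [simp]: "al \<xi> = 0"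
proof (rule ph_inj)
  have "G \<xi> \<xi> + G \<xi> \<xi> = 0"
    using nearly_sasakian[of \<xi> \<xi>] by (simp add: ip_xi eta_xi fun_smult_def fun_eq_iff)
  then have "- ph (al \<xi>) - ph (al \<xi>) = 0"
    by (simp add: G_xi_right)
  then show "ph (al \<xi>) = 0"
    by (auto simp: fun_eq_iff)
qed simp

lemma G_xi_left:
  assumes "X \<in> H"
  shows "G \<xi> X = ph (al X) - X"
proof -
  have "G \<xi> X + G X \<xi> = - X"
    using nearly_sasakian[of \<xi> X] assms by (simp add: eta_xi fun_smult_def fun_eq_iff)
  then show ?thesis
    using assms by (simp add: G_xi_right algebra_simps)
qed

lemma D_xi_H [simp]: "X \<in> H \<Longrightarrow> D \<xi> X \<in> H"
  using ip_D_orthogonal[of \<xi> X \<xi>] ip_commute[of X 0] by (intro H_I) simp_all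

lemma Q_tilde_app: "endo_app (Q_tilde Q) X = q X - X"
  by (simp add: endo_app_def Q_tilde_def fun_eq_iff)

section \<open>Condition (i) forces Q = id\<close>

lemma D_q:
  assumes "X \<in> V" "Y \<in> H"
  shows "D X (q Y) = q (D X Y)"
  using Q_tilde_parallel[OF assms] assms by (simp add: cov_deriv_endo_def Q_tilde_app)

text \<open>Let T = Q - id and Z = T(\<open>al X\<close>). As T is self-adjoint, |Z|^2 = g(TZ,
  \<nabla>_X \<xi>) = -g(\<nabla>_X(TZ), \<xi>). By (i) this is -g(T\<nabla>_X Z, \<xi>), which
  vanishes since T\<xi> = 0.\<close>

lemma q_al:
  assumes "X \<in> V"
  shows "q (al X) = al X"
proof -
  define Z where "Z = q (al X) - al X"
  have Z: "Z \<in> H"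
    using assms by (simp add: Z_def)
  have "ip (q Z - Z) (al X) p = 0" for p
  proof -
    have "ip (q Z - Z) (al X) p = - ip (D X (q Z - Z)) \<xi> p"
      using assms Z ip_D_orthogonal[of X "q Z - Z" \<xi> p] by simp
    also have "\<dots> = 0"
      using assms Z ip_q[of "D X Z" \<xi> p] by (simp add: D_q)
    finally show ?thesis .
  qed
  moreover have "ip Z Z p = ip (q Z - Z) (al X) p" for p
  proof -
    have "ip Z Z p = ip Z (q (al X)) p - ip Z (al X) p"
      by (subst (2) Z_def) (use assms Z in simp)
    then show ?thesis
      using assms Z ip_q[of Z "al X" p] by simp
  qed
  ultimately have "ip Z Z p = 0" for p
    by metis
  then have "Z = 0"
    using Z by (intro ip_self_eq_0) simp_all
  then show ?thesis by (simp add: Z_def)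
qed

text \<open>On ker \<eta>, \<phi>^2 = -Q commutes with \<open>D \<xi>\<close>, so
  \<open>G \<xi>\<close> anticommutes with \<phi>. Inserting \<open>G_xi_left\<close> and cancelling
  \<phi> by \<open>ph_inj\<close> gives the identity.\<close>

lemma ph_al:
  assumes "X \<in> H"
  shows "ph (al X) - X = X - al (ph X)"
proof -
  have "D \<xi> (ph (ph X)) = ph (ph (D \<xi> X))"
    using assms by (simp add: ph_ph vert_H D_q)
  then have "G \<xi> (ph X) + ph (G \<xi> X) = 0"
    using assms by (simp add: cov_deriv_endo_def)
  moreover define U W where "U = al (ph X) - X" and "W = ph (al X) - X"
  ultimately have "ph U + ph W = 0" and UW: "U \<in> H" "W \<in> H"
    using assms by (simp_all add: G_xi_left)
  then have "U + W = 0"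
    by (intro ph_inj[of "U + W"]) simp_all
  then have "W = - U"
    using add_eq_0_iff by blast
  then show ?thesis by (simp add: U_def W_def)
qed

lemma q_ph: "X \<in> H \<Longrightarrow> q (ph X) = ph (q X)"
  using ph_ph[of X] ph_ph[of "ph X"] by (simp add: vert_H)

text \<open>Applying Q to \<open>ph_al\<close> fixes both \<open>al\<close> terms by
  \<open>q_al\<close> and \<open>q_ph\<close>, so comparison with \<open>ph_al\<close> itself gives
  2QX = 2X on ker \<eta>. The vertical part is covered by Q\<xi> = \<xi>.\<close>

lemma q_id [simp]:
  assumes "X \<in> V"
  shows "q X = X"
proof -
  have H: "q X = X" if X: "X \<in> H" for X
  proof (intro ext)
    fix p f
    have "q (ph (al X) - X) = q (X - al (ph X))"
      using ph_al[OF X] by (rule arg_cong)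
    then have "ph (al X) - q X = q X - al (ph X)"
      using X by (simp add: q_ph q_al)
    then have "(ph (al X) - q X) p f = (q X - al (ph X)) p f"
      by (simp only:)
    moreover have "(ph (al X) - X) p f = (X - al (ph X)) p f"
      using ph_al[OF X] by (simp only:)
    ultimately show "q X p f = X p f"
      by simp
  qed
  have "q (X - vert X) = X - vert X"
    using assms by (intro H) simp
  then show ?thesis
    using assms by simp
qed

section \<open>Curvature of nearly Sasakian structures\<close>

lemma ph_ph_H [simp]: "X \<in> H \<Longrightarrow> ph (ph X) = - X"
  by (simp add: ph_ph vert_H)

lemma ip_vert: "X \<in> V \<Longrightarrow> Y \<in> H \<Longrightarrow> ip (vert X) Y p = 0"
  by (simp add: ip_smult_left)

section \<open>Skew symmetries of \<phi> and \<nabla>\<phi>\<close>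

lemma ph_skew:
  assumes "X \<in> V" "Y \<in> V"
  shows "ip (ph X) Y p = - ip X (ph Y) p"
proof -
  have "ip (ph X) (ph (ph Y)) p = ip X (ph Y) p"
    using assms by (subst ip_ph_ph) simp_all
  then show ?thesis
    using assms ip_vert[of Y "ph X" p] ip_commute[of "ph X" "vert Y"] by (simp add: ph_ph)
qed

lemma G_skew:
  assumes "X \<in> V" "Y \<in> V" "Z \<in> V"
  shows "ip (G X Y) Z p = - ip (G X Z) Y p"
proof -
  have "ip (D X (ph Y)) Z p + ip (ph Y) (D X Z) p = - ip (D X Y) (ph Z) p - ip Y (D X (ph Z)) p"
    using assms by (intro deriv_ip_skew) (simp_all add: ph_skew)
  then have "ip (G X Y) Z p = - ip Y (G X Z) p"
    using assms by (simp add: cov_deriv_endo_def ph_skew)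
  then show ?thesis
    using assms ip_commute[of Y "G X Z"] by simp
qed

text \<open>For horizontal X, Y the symmetrised \<open>G\<close> is a multiple of \<xi>, which Z
  does not see. With \<open>G_skew\<close>, \<open>ip (G X Y) Z\<close> is totally skew on ker
  \<eta>.\<close>

lemma G_swap:
  assumes "X \<in> H" "Y \<in> H" "Z \<in> H"
  shows "ip (G X Y) Z p = - ip (G Y X) Z p"
proof -
  have "G X Y + G Y X = (\<lambda>p. 2 * ip X Y p) *\<^sub>V \<xi>"
    using assms nearly_sasakian[of X Y] by (simp add: fun_eq_iff fun_smult_def)
  then have "ip (G X Y + G Y X) Z p = 0"
    using assms by (simp add: ip_smult_left)
  then show ?thesis
    using assms by simp
qed

text \<open>Differentiate \<phi>^2 = -id on ker \<eta>: the error is vertical, hence invisible to Z,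
  and skewness moves \<phi> onto Z.\<close>

lemma G_ph:
  assumes "X \<in> V" "Y \<in> H" "Z \<in> H"
  shows "ip (G X (ph Y)) Z p = ip (G X Y) (ph Z) p"
proof -
  have "G X (ph Y) + ph (G X Y) = - vert (D X Y)"
    using assms by (simp add: cov_deriv_endo_def ph_ph[of "D X Y"])
  then have "ip (G X (ph Y) + ph (G X Y)) Z p = 0"
    using assms by (simp add: ip_vert)
  then show ?thesis
    using assms by (simp add: ph_skew)
qed

lemma G_diff [simp]:
  assumes "X \<in> V" "Y \<in> V" "Z \<in> V"
  shows "G (X - Y) Z = G X Z - G Y Z" and "G X (Y - Z) = G X Y - G X Z"
  using assms by (simp_all add: cov_deriv_endo_def)

lemma G_minus [simp]:
  assumes "X \<in> V" "Y \<in> V"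
  shows "G (- X) Y = - G X Y" and "G X (- Y) = - G X Y"
  using assms by (simp_all add: cov_deriv_endo_def)

text \<open>A form of \<open>G_xi_left\<close> for fields with a vertical part, such as
  \<open>D X Y\<close>.\<close>

lemma ip_G_xi:
  assumes "X \<in> V" "Y \<in> H"
  shows "ip (G \<xi> X) Y p = ip (ph (al X)) Y p - ip X Y p"
proof -
  have "G \<xi> X + G X \<xi> = vert X - X"
    using assms nearly_sasakian[of \<xi> X] ip_commute[of \<xi> X]
    by (simp add: fun_eq_iff fun_smult_def ip_xi eta_xi)
  then have "ip (G \<xi> X + G X \<xi>) Y p = - ip X Y p"
    using assms by (simp add: ip_vert)
  then show ?thesis
    using assms by (simp add: G_xi_right)
qed

section \<open>\<xi> is Killing; its second covariant derivative\<close>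

lemma D_vert: "X \<in> V \<Longrightarrow> Y \<in> V \<Longrightarrow> D (vert X) Y = form_app \<eta> X *\<^sub>V D \<xi> Y"
  by (simp add: D_smult eta_smooth)

text \<open>On ker \<eta>, skewness of \<open>G \<xi>\<close> together with \<open>ph_al\<close>
  gives the claim for \<phi>Y in place of Y, and \<phi> is onto there. Vertical parts contribute
  nothing, as \<open>al \<xi>\<close> = 0 and \<open>al X\<close> is horizontal.\<close>

lemma al_skew:
  assumes "X \<in> V" "Y \<in> V"
  shows "ip (al X) Y p = - ip (al Y) X p"
proof -
  have H: "ip (al X) Y p = - ip (al Y) X p" if XY: "X \<in> H" "Y \<in> H" for X Y
  proof -
    have *: "ip (al X) (ph Y) p = - ip (al (ph Y)) X p" if "Y \<in> H" for Y
    proof -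
      have "ip (ph (al X) - X) Y p = - ip (ph (al Y) - Y) X p"
        using G_skew[of \<xi> X Y p] XY that by (simp add: G_xi_left del: ip_diff_left)
      also have "\<dots> = - ip (Y - al (ph Y)) X p"
        using that by (simp only: ph_al)
      finally show ?thesis
        using XY that ip_commute[of Y X] by (simp add: ph_skew)
    qed
    show ?thesis
      using *[of "- ph Y"] XY by simp
  qed
  have al: "al (X - vert X) = al X" if "X \<in> V" for X
    using that by (simp add: D_vert smult_zero)
  have ip: "ip (al X) (Y - vert Y) p = ip (al X) Y p" if "X \<in> V" "Y \<in> V" for X Y
    using that ip_commute[of "al X" "vert Y"] by (simp add: ip_vert)
  show ?thesis
    using H[of "X - vert X" "Y - vert Y"] assms by (simp only: al ip horizontal_part)
qed

text \<open>This is (\<nabla>_X a)Y for the endomorphism a = \<nabla>\<xi>.\<close>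

abbreviation rr where "rr X Y \<equiv> D X (al Y) - al (D X Y)"

lemma rr_skew:
  assumes "X \<in> V" "Y \<in> V" "Z \<in> V"
  shows "ip (rr X Y) Z p = - ip (rr X Z) Y p"
proof -
  have "ip (D X (al Y)) Z p + ip (al Y) (D X Z) p = - ip (D X (al Z)) Y p - ip (al Z) (D X Y) p"
    using assms by (intro deriv_ip_skew al_skew) simp_all
  then show ?thesis
    using assms al_skew[of "D X Y" Z p] al_skew[of "D X Z" Y p] by simp
qed

lemma rr_curvature:
  assumes "X \<in> V" "Y \<in> V"
  shows "rr X Y - rr Y X = R X Y \<xi>"
  using assms by (simp add: curvature_def torsion_free algebra_simps)

lemma ip_rr_curvature:
  assumes "X \<in> V" "Y \<in> V" "Z \<in> V"
  shows "ip (rr X Y) Z p - ip (rr Y X) Z p = - ip (R X Y Z) \<xi> p"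
proof -
  have "ip (rr X Y - rr Y X) Z p = ip (R X Y \<xi>) Z p"
    using assms by (simp only: rr_curvature)
  then show ?thesis
    using assms ip_curvature_skew[of X Y \<xi> Z p] by simp
qed

text \<open>The 2-form g(\<open>al X\<close>, Y) is closed: by skewness of \<open>rr\<close>, the
  Bianchi sum paired with \<xi> is, up to sign, twice this cyclic sum.\<close>

lemma rr_cyclic:
  assumes "X \<in> V" "Y \<in> V" "Z \<in> V"
  shows "ip (rr X Y) Z p + ip (rr Y Z) X p + ip (rr Z X) Y p = 0"
  using ip_rr_curvature[OF assms(1,2,3), of p] ip_rr_curvature[OF assms(2,3,1), of p]
    ip_rr_curvature[OF assms(3,1,2), of p] ip_bianchi[OF assms xi_V, of p]
    rr_skew[OF assms(1,2,3), of p] rr_skew[OF assms(2,3,1), of p] rr_skew[OF assms(3,1,2), of p]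
  by linarith

text \<open>The classical identity for Killing fields, from pair symmetry and
  \<open>rr_cyclic\<close>.\<close>

lemma rr_eq_curvature:
  assumes "X \<in> V" "Y \<in> V" "Z \<in> V"
  shows "ip (rr X Y) Z p = ip (R X \<xi> Y) Z p"
  using ip_curvature_pair_symmetric[OF assms(1) xi_V assms(2,3), of p]
    ip_rr_curvature[OF assms(2,3,1), of p] rr_cyclic[OF assms, of p] rr_skew[OF assms(3,2,1), of p]
  by linarith

section \<open>The second covariant derivative of \<phi>\<close>

text \<open>\<open>hess X Y Z\<close> is \<open>(\<nabla>\<^sup>2\<^bsub>X,Y\<^esub>\<phi>)Z\<close>.\<close>

definition hess where "hess X Y Z = D X (G Y Z) - G (D X Y) Z - G Y (D X Z)"

lemma hess_V [simp]: "X \<in> V \<Longrightarrow> Y \<in> V \<Longrightarrow> Z \<in> V \<Longrightarrow> hess X Y Z \<in> V"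
  by (simp add: hess_def)

lemma ricci_identity:
  assumes "X \<in> V" "Y \<in> V" "Z \<in> V"
  shows "hess X Y Z - hess Y X Z = R X Y (ph Z) - ph (R X Y Z)"
  using assms by (simp add: hess_def curvature_def torsion_free cov_deriv_endo_def algebra_simps)

lemma hess_skew:
  assumes "X \<in> V" "Y \<in> V" "Z \<in> V" "W \<in> V"
  shows "ip (hess X Y Z) W p = - ip (hess X Y W) Z p"
proof -
  have "ip (D X (G Y Z)) W p + ip (G Y Z) (D X W) p
      = - ip (D X (G Y W)) Z p - ip (G Y W) (D X Z) p"
    using assms by (intro deriv_ip_skew G_skew) simp_all
  then show ?thesis
    using assms G_skew[of "D X Y" Z W p] G_skew[of Y "D X Z" W p] G_skew[of Y "D X W" Z p]
    by (simp add: hess_def)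
qed

text \<open>\<open>G_swap\<close> holds on ker \<eta> only; it can be differentiated along \<xi>
  because \<open>D \<xi>\<close> preserves ker \<eta>.\<close>

lemma hess_xi_swap:
  assumes "X \<in> H" "Y \<in> H" "Z \<in> H"
  shows "ip (hess \<xi> X Y) Z p = - ip (hess \<xi> Y X) Z p"
proof -
  have "ip (D \<xi> (G X Y)) Z p + ip (G X Y) (D \<xi> Z) p
      = - ip (D \<xi> (G Y X)) Z p - ip (G Y X) (D \<xi> Z) p"
    using assms by (intro deriv_ip_skew G_swap) simp_all
  then show ?thesis
    using assms G_swap[of "D \<xi> X" Y Z p] G_swap[of X "D \<xi> Y" Z p] G_swap[of X Y "D \<xi> Z" p]
    by (simp add: hess_def)
qed

text \<open>Differentiate \<open>G_xi_left\<close> along X; the last term comes from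
  \<open>D X \<xi>\<close> in the middle slot of \<open>hess\<close>.\<close>

lemma hess_xi:
  assumes "X \<in> V" "Y \<in> H" "Z \<in> H"
  shows "ip (hess X \<xi> Y) Z p =
    ip (G X (al Y)) Z p - ip (rr X Y) (ph Z) p - ip (G (al X) Y) Z p"
proof -
  have "D X (G \<xi> Y) = G X (al Y) + ph (D X (al Y)) - D X Y"
    unfolding G_xi_left[OF assms(2)] using assms by (simp add: cov_deriv_endo_def)
  then show ?thesis
    using assms by (simp add: hess_def ip_G_xi ph_skew)
qed

section \<open>The tensors \<open>h\<close>, \<open>c\<close> and \<open>t\<close> on ker
  \<eta>\<close>

definition h where "h X = al X + ph X"

lemma h_H [simp]: "X \<in> V \<Longrightarrow> h X \<in> H"
  by (simp add: h_def)

text \<open>A Sasakian structure has \<nabla>\<xi> = -\<phi>, so \<open>h\<close> measures the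
  deviation from it. \<open>ph_al\<close> and \<phi>^2 = -id give the anticommutation.\<close>

lemma h_ph:
  assumes "X \<in> H"
  shows "h (ph X) = - ph (h X)"
  using ph_al[OF assms] assms by (simp add: h_def algebra_simps)

abbreviation c where "c p X Y Z \<equiv> ip (G X Y) Z p"

text \<open>Up to sign, \<open>t\<close> is what \<open>hess_xi\<close> leaves after removing the
  \<open>c\<close> terms that are visibly skew in Y and Z; this is how \<open>t_skew\<close>
  works.\<close>

definition t where "t p X Y Z = ip (rr X Y) (ph Z) p - c p X (h Y) Z"

lemma c_h:
  assumes "X \<in> H" "Y \<in> H" "Z \<in> H"
  shows "c p X (al Y) Z = c p X (h Y) Z - c p X (ph Y) Z"
    and "c p (al X) Y Z = c p (h X) Y Z - c p (ph X) Y Z"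
proof -
  have al: "al X = h X - ph X" for X
    by (simp add: h_def)
  show "c p X (al Y) Z = c p X (h Y) Z - c p X (ph Y) Z"
    "c p (al X) Y Z = c p (h X) Y Z - c p (ph X) Y Z"
    using assms by (simp_all add: al)
qed

lemma c_cyclic: "X \<in> H \<Longrightarrow> Y \<in> H \<Longrightarrow> Z \<in> H \<Longrightarrow> c p X Y Z = c p Y Z X"
  using G_swap[of X Y Z p] G_skew[of Y X Z p] by simp

text \<open>With \<open>G_ph\<close> and \<open>c_cyclic\<close>, \<phi> can move freely between the
  three slots of \<open>c\<close>.\<close>

lemma c_ph: "X \<in> H \<Longrightarrow> Y \<in> H \<Longrightarrow> Z \<in> H \<Longrightarrow> c p (ph X) Y Z = c p X (ph Y) Z"
  using G_ph[of Y Z X p] c_cyclic[of "ph X" Y Z p] c_cyclic[of X "ph Y" Z p] G_ph[of X Y Z p]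
    c_cyclic[of X Y "ph Z" p] by simp

lemma t_skew:
  assumes "X \<in> H" "Y \<in> H" "Z \<in> H"
  shows "t p X Y Z = - t p X Z Y"
proof -
  have "ip (hess X \<xi> Y) Z p = - ip (hess X \<xi> Z) Y p"
    using assms by (intro hess_skew) simp_all
  moreover have "c p X (ph Y) Z = - c p X (ph Z) Y"
    using assms G_ph[of X Y Z p] G_skew[of X Y "ph Z" p] by simp
  ultimately show ?thesis
    using assms hess_xi[of X Y Z p] hess_xi[of X Z Y p] G_skew[of "al X" Y Z p]
      c_h(1)[of X Y Z p] c_h(1)[of X Z Y p]
    by (simp add: t_def del: G_diff ip_diff_left)
qed

lemma t_swap:
  assumes "X \<in> H" "Y \<in> H" "Z \<in> H"
  shows "t p X Y Z = - t p Y X Z"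
proof -
  \<comment> \<open>The Ricci identity exchanges X and \<xi>. The three \<open>c\<close> terms
    together change sign when X and Y are swapped, and so does the left side, which leaves
    \<open>t\<close>.\<close>
  have *: "ip (hess \<xi> X Y) Z p = - 3 * t p X Y Z - c p X (h Y) Z - c p X Y (h Z) - c p (h X) Y Z"
    if "X \<in> H" "Y \<in> H" "Z \<in> H" for X Y Z
  proof -
    have "ip (hess X \<xi> Y - hess \<xi> X Y) Z p = ip (R X \<xi> (ph Y) - ph (R X \<xi> Y)) Z p"
      using that by (simp only: ricci_identity H_V xi_V)
    then have "ip (hess X \<xi> Y) Z p - ip (hess \<xi> X Y) Z p
        = ip (rr X (ph Y)) Z p + ip (rr X Y) (ph Z) p"
      using that by (simp add: ph_skew rr_eq_curvature del: ip_diff_left D_diff)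
         (simp add: ph_skew)
    moreover have "ip (rr X (ph Y)) Z p = - ip (rr X Z) (ph Y) p"
      using that by (intro rr_skew) simp_all
    moreover have "ip (rr X U) (ph W) p = t p X U W + c p X (h U) W" for U W
      by (simp add: t_def)
    ultimately show ?thesis
      using that hess_xi[of X Y Z p] c_h[of X Y Z p] c_ph[of X Y Z p] t_skew[of X Z Y p]
        G_skew[of X "h Z" Y p]
      by (simp del: ip_diff_left G_diff)
  qed
  show ?thesis
    using *[OF assms] *[OF assms(2,1,3)] hess_xi_swap[OF assms, of p]
      G_swap[of X "h Y" Z p] G_swap[of Y "h X" Z p] G_swap[of X Y "h Z" p] assms
    by simp
qed

lemma t_cyclic: "X \<in> H \<Longrightarrow> Y \<in> H \<Longrightarrow> Z \<in> H \<Longrightarrow> t p X Y Z = t p Y Z X"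
  using t_swap[of X Y Z p] t_skew[of Y X Z p] by simp

section \<open>How \<open>t\<close> depends on \<phi>: skew symmetry and Bianchi\<close>

lemma rr_eq_t:
  assumes "X \<in> H" "Y \<in> H" "Z \<in> H"
  shows "ip (rr X Y) Z p = - t p X Y (ph Z) - c p (ph X) (h Y) Z"
proof -
  have "ip (rr X Y) (ph (ph Z)) p = - ip (rr X Y) Z p"
    using assms by simp
  moreover have "c p X (h Y) (ph Z) = c p (ph X) (h Y) Z"
    using assms G_ph[of X "h Y" Z p] c_ph[of X "h Y" Z p] by simp
  ultimately show ?thesis
    unfolding t_def by linarith
qed

text \<open>Skewness of \<open>rr\<close> in Y and Z, rewritten by \<open>rr_eq_t\<close>:
  \<open>t\<close> with \<phi> in a slot minus \<open>c\<close> with \<open>h\<close> in that slot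
  does not depend on which of the last two slots is taken.\<close>

lemma t_ph_right:
  assumes "X \<in> H" "Y \<in> H" "Z \<in> H"
  shows "t p X Y (ph Z) - c p (ph X) Y (h Z) = t p X (ph Y) Z - c p (ph X) (h Y) Z"
  using rr_eq_t[OF assms, of p] rr_eq_t[OF assms(1,3,2), of p] rr_skew[of X Y Z p]
    t_skew[of X "ph Y" Z p] G_skew[of "ph X" "h Z" Y p] assms by simp

lemma t_ph_left:
  assumes "X \<in> H" "Y \<in> H" "Z \<in> H"
  shows "t p X (ph Y) Z - c p (ph X) (h Y) Z = t p (ph X) Y Z - c p (h X) (ph Y) Z"
proof -
  have "c p (ph Z) X (h Y) = c p (ph X) (h Y) Z"
    using assms c_ph[of Z X "h Y" p] c_cyclic[of Z "ph X" "h Y" p] by simp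
  moreover have "c p (ph Z) (h X) Y = c p (h X) (ph Y) Z"
    using assms c_cyclic[of "ph Z" "h X" Y p] G_ph[of "h X" Y Z p] by simp
  ultimately show ?thesis
    using t_ph_right[OF assms(3,1,2), of p] t_cyclic[of Z X "ph Y" p] t_cyclic[of Z "ph X" Y p] assms
    by simp
qed

abbreviation S where "S p X Y Z \<equiv> c p (h X) (ph Y) Z + c p (ph X) (h Y) Z + c p (ph X) Y (h Z)"

text \<open>By \<open>t_ph_left\<close> and \<open>t_ph_right\<close> the three differences of
  \<open>t\<close> and \<open>c\<close> agree. Bianchi makes the three \<open>t\<close> terms sum to
  -\<open>S\<close>, so their common value is -2\<open>S\<close>/3.\<close>

lemma t_ph:
  assumes "X \<in> H" "Y \<in> H" "Z \<in> H"
  shows "3 * t p (ph X) Y Z = 3 * c p (h X) (ph Y) Z - 2 * S p X Y Z"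
    and "3 * t p X (ph Y) Z = 3 * c p (ph X) (h Y) Z - 2 * S p X Y Z"
    and "3 * t p X Y (ph Z) = 3 * c p (ph X) Y (h Z) - 2 * S p X Y Z"
proof -
  have "c p (ph Y) (h Z) X = c p (ph X) Y (h Z)"
    using assms c_ph[of Y "h Z" X p] c_cyclic[of "ph X" Y "h Z" p] G_ph[of Y "h Z" X p]
      c_ph[of X Y "h Z" p] by simp
  moreover have "c p (ph Z) (h X) Y = c p (h X) (ph Y) Z"
    using assms c_cyclic[of "ph Z" "h X" Y p] G_ph[of "h X" Y Z p] by simp
  ultimately have "t p (ph X) Y Z + t p X (ph Y) Z + t p X Y (ph Z) + S p X Y Z = 0"
    using rr_cyclic[of X Y Z p] rr_eq_t[OF assms(1,2,3), of p] rr_eq_t[OF assms(2,3,1), of p]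
      rr_eq_t[OF assms(3,1,2), of p] t_cyclic[of "ph X" Y Z p] t_cyclic[of Z X "ph Y" p] assms
    by simp
  then show "3 * t p (ph X) Y Z = 3 * c p (h X) (ph Y) Z - 2 * S p X Y Z"
    "3 * t p X (ph Y) Z = 3 * c p (ph X) (h Y) Z - 2 * S p X Y Z"
    "3 * t p X Y (ph Z) = 3 * c p (ph X) Y (h Z) - 2 * S p X Y Z"
    using t_ph_left[OF assms, of p] t_ph_right[OF assms, of p] by simp_all
qed

text \<open>The lemma \<open>t_ph\<close> gives two expressions for \<open>t (\<phi>X) (\<phi>Y) Z\<close>; comparing them yields the claim.\<close>

lemma c_h_left:
  assumes "X \<in> H" "Y \<in> H" "Z \<in> H"
  shows "c p (h X) Y Z = c p X (h Y) Z"
proof -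
  have ph2: "c p (ph X) (ph Y) Z = - c p X Y Z" if "X \<in> H" "Y \<in> H" "Z \<in> H" for X Y Z
    using that c_ph[of X "ph Y" Z p] by simp
  \<comment> \<open>Two \<phi> in different slots give -1; where \<open>h\<close> meets \<phi> in
    one slot, anticommuting gives a further sign.\<close>
  have "S p X (ph Y) Z = - c p (h X) Y Z + c p X (h Y) Z - c p X Y (h Z)"
    using assms by (simp add: h_ph ph2)
  moreover have "S p (ph X) Y Z = c p (h X) Y Z - c p X (h Y) Z - c p X Y (h Z)"
    using assms by (simp add: h_ph ph2)
  ultimately show ?thesis
    using t_ph(1)[of X "ph Y" Z p] t_ph(2)[of "ph X" Y Z p] assms by simp
qed

text \<open>Both \<open>h\<close> and \<phi> can be moved between slots of \<open>c\<close>, yet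
  they anticommute; carrying \<open>h\<close> to the third slot and back past \<phi> shows that the
  value equals its negative.\<close>

lemma c_h_zero:
  assumes "X \<in> H" "Y \<in> H" "Z \<in> H"
  shows "c p (h X) Y Z = 0"
proof -
  have *: "c p (h X) (ph Y) Z = 0" if "X \<in> H" "Y \<in> H" "Z \<in> H" for X Y Z
  proof -
    have a: "c p X Y (h Z) = c p (h X) Y Z" if "X \<in> H" "Y \<in> H" "Z \<in> H" for X Y Z
      using that c_cyclic[of X Y "h Z" p] c_cyclic[of Y "h Z" X p] c_h_left[of Z X Y p]
        c_cyclic[of Z "h X" Y p] by simp
    have "c p (h X) (ph Y) Z = c p X (ph Y) (h Z)"
      using that a[of X "ph Y" Z] by simp
    also have "\<dots> = c p (ph X) Y (h Z)"
      using that by (simp add: c_ph)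
    also have "\<dots> = c p (h (ph X)) Y Z"
      using that a[of "ph X" Y Z] by simp
    also have "\<dots> = - c p (h X) (ph Y) Z"
      using that by (simp add: h_ph c_ph)
    finally show ?thesis by simp
  qed
  show ?thesis
    using *[of X "- ph Y" Z] assms by simp
qed

section \<open>Vanishing of the curvature terms\<close>

lemma ip_rr_H:
  assumes "X \<in> H" "Y \<in> H" "Z \<in> H"
  shows "ip (rr X Y) Z p = 0"
proof -
  have "c p (ph X) (h Y) Z = 0" "c p (ph X) Y (h Z) = 0" "c p (h X) (ph Y) Z = 0"
    using assms c_h_zero[of X "ph Y" Z p] c_h_zero[of Y Z "ph X" p] c_h_zero[of Z "ph X" Y p]
      c_cyclic[of "ph X" "h Y" Z p] c_cyclic[of "ph X" Y "h Z" p] c_cyclic[of Y "h Z" "ph X" p]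
    by simp_all
  then show ?thesis
    using t_ph(3)[OF assms, of p] rr_eq_t[OF assms, of p] by simp
qed

text \<open>\<open>ip_rr_H\<close> covers horizontal X. \<open>rr\<close> is tensorial in its first
  argument, so the vertical part reduces to \<open>R \<xi> \<xi> Y\<close>, which vanishes.\<close>

lemma curvature_xi_H:
  assumes "X \<in> V" "Y \<in> H" "Z \<in> H"
  shows "ip (R X \<xi> Y) Z p = 0"
proof -
  have "rr (vert X) Y = form_app \<eta> X *\<^sub>V rr \<xi> Y"
    using assms by (simp add: D_smult eta_smooth) (simp add: fun_smult_def fun_eq_iff algebra_simps)
  moreover have "ip (rr \<xi> Y) Z p = 0"
    using assms ip_curvature_swap[of \<xi> \<xi> Y Z p] rr_eq_curvature[of \<xi> Y Z p] by simp
  ultimately have "ip (rr (vert X) Y) Z p = 0"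
    using assms by (simp add: ip_smult_left del: ip_diff_left)
  moreover have "rr (X - vert X) Y = rr X Y - rr (vert X) Y"
    using assms by simp
  ultimately have "ip (rr X Y) Z p = ip (rr (X - vert X) Y) Z p"
    using assms by simp
  also have "\<dots> = 0"
    using assms by (intro ip_rr_H) simp_all
  finally show ?thesis
    using assms by (simp only: rr_eq_curvature H_V)
qed

lemma curvature_H:
  assumes "X \<in> H" "Y \<in> H" "Z \<in> H"
  shows "R X Y Z \<in> H"
proof (rule H_I)
  show "ip (R X Y Z) \<xi> p = 0" for p
    using assms ip_curvature_pair_symmetric[of X Y Z \<xi> p] curvature_xi_H[of Z X Y p] by simp
qed (use assms in simp)

end

theorem proposition1:
  fixes A :: "('m::{t2_space,second_countable_topology}, 'e::euclidean_space) chart set"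
    and \<phi> Q :: "'m endo_field" and \<xi> :: "'m vfield" and \<eta> :: "'m form_field"
    and g :: "'m bilin_field" and D :: "'m connection" and n :: nat
  assumes "n \<ge> 1" and "DIM('e) = 2 * n + 1"
    and "smooth_atlas A"
    and "weak_nearly_sasakian A D \<phi> Q \<xi> \<eta> g"
    and "\<forall>X\<in>vector_fields A. \<forall>Y\<in>kernel_fields A \<eta>. cov_deriv_endo D (Q_tilde Q) X Y = 0"
    and "\<forall>X\<in>kernel_fields A \<eta>. \<forall>Y\<in>kernel_fields A \<eta>. \<forall>Z\<in>kernel_fields A \<eta>.
           curvature D (endo_app (Q_tilde Q) X) Y Z \<in> kernel_fields A \<eta>"
  shows "(\<forall>X\<in>vector_fields A. \<forall>Y\<in>vector_fields A. \<forall>Z\<in>vector_fields A.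
            bilin_app g (curvature D \<xi> Z (endo_app \<phi> X)) (endo_app \<phi> Y) = 0) \<and>
         curvature_invariant A D \<eta>"
proof -
  interpret parallel_weak_nearly_sasakian A \<phi> Q \<xi> \<eta> g D
    using assms(3-5) by unfold_locales simp_all
  \<comment> \<open>\<phi>X and \<phi>Y lie in ker \<eta>, so \<open>curvature_xi_H\<close> applies
    once \<xi> and Z are swapped.\<close>
  have "ip (R \<xi> Z (ph X)) (ph Y) p = 0" if "X \<in> V" "Y \<in> V" "Z \<in> V" for X Y Z p
    using that ip_curvature_swap[of \<xi> Z "ph X" "ph Y" p] curvature_xi_H[of Z "ph X" "ph Y" p]
    by simp
  then show ?thesis
    by (auto simp: curvature_invariant_def fun_eq_iff intro: curvature_H)
qed

end
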